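(* Let $k\geq 3$ and $n\geq 1$ be integers such that $n$ is not a power of $k$. Then the shuffle group $G_{k,kn}$ is $2$-transitive on $[kn]$.
   Context: For a positive integer $m$, let $[m]=\{0,1,\ldots,m-1\}$. Permutations act on the right, written $x^g$, and products are read left to right. For positive integers $k,n$, every element of $[kn]$ is uniquely $i+jn$ with $i\in[n]$, $j\in[k]$. The standard shuffle $\sigma\in\mathrm{Sym}([kn])$ is defined by $(i+jn)^{\sigma}=ik+j$ for all $i\in[n]$, $j\in[k]$. For $\tau\in\mathrm{Sym}([k])$, the permutation $\rho_\tau\in\mathrm{Sym}([kn])$ is defined by $(i+jn)^{\rho_\tau}=i+j^\tau n$ for all $i\in[n]$, $j\in[k]$. The shuffle group is $G_{k,kn}=\langle \rho_\tau\sigma\mid\tau\in\mathrm{Sym}([k])\rangle=\langle\sigma,\rho_\tau\mid\tau\in\mathrm{Sym}([k])\rangle\leq\mathrm{Sym}([kn])$. Powers of $k$ are the integers $k^e$ with $e\geq 0$ (so $1=k^0$ counts as a power of $k$). *)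

theory Defs
  imports "HOL-Algebra.Generated_Groups" "HOL-Combinatorics.Permutations"
begin

text \<open>
  Permutations act on the right and products are read from left to right:
  \<open>p \<otimes> q\<close> applies \<open>p\<close> first. A point \<open>x\<close> moved by \<open>p\<close> is written \<open>p x\<close>.
  The set \<open>[m]\<close> is \<open>{..<m}\<close>.
\<close>

definition Sym :: "'a set \<Rightarrow> ('a \<Rightarrow> 'a) monoid" where
  "Sym S = \<lparr>carrier = {p. p permutes S}, monoid.mult = (\<lambda>p q. q \<circ> p), one = id\<rparr>"

text \<open>
  A point \<open>x < k * n\<close> is \<open>i + j * n\<close> with \<open>i = x mod n\<close> and \<open>j = x div n\<close>.
  Outside \<open>[k * n]\<close> the functions below are the identity, as \<open>permutes\<close> demands.
\<close>

definition std_shuffle :: "nat \<Rightarrow> nat \<Rightarrow> nat \<Rightarrow> nat" where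
  "std_shuffle k n x = (if x < k * n then (x mod n) * k + x div n else x)"

definition pile_perm :: "nat \<Rightarrow> nat \<Rightarrow> (nat \<Rightarrow> nat) \<Rightarrow> nat \<Rightarrow> nat" where
  "pile_perm k n \<tau> x = (if x < k * n then x mod n + \<tau> (x div n) * n else x)"

definition shuffle_group :: "nat \<Rightarrow> nat \<Rightarrow> (nat \<Rightarrow> nat) set" where
  "shuffle_group k n =
     generate (Sym {..<k * n})
       {pile_perm k n \<tau> \<otimes>\<^bsub>Sym {..<k * n}\<^esub> std_shuffle k n | \<tau>. \<tau> permutes {..<k}}"

definition two_transitive_on :: "('a \<Rightarrow> 'a) set \<Rightarrow> 'a set \<Rightarrow> bool" where
  "two_transitive_on G S \<longleftrightarrow>
     (\<forall>x\<in>S. \<forall>y\<in>S. \<forall>u\<in>S. \<forall>v\<in>S. x \<noteq> y \<longrightarrow> u \<noteq> v \<longrightarrow> (\<exists>g\<in>G. g x = u \<and> g y = v))"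

lemma group_Sym: "group (Sym S)"
proof (rule groupI)
  fix p assume "p \<in> carrier (Sym S)"
  then have "p permutes S" by (simp add: Sym_def)
  then show "\<exists>q\<in>carrier (Sym S). q \<otimes>\<^bsub>Sym S\<^esub> p = \<one>\<^bsub>Sym S\<^esub>"
    by (intro bexI[of _ "inv_into UNIV p"]) (auto simp: Sym_def permutes_inv permutes_inv_o)
qed (auto simp: Sym_def permutes_compose permutes_id comp_assoc)

lemma add_mult_less:
  fixes i j k n :: nat
  assumes "i < n" "j < k"
  shows "i + j * n < k * n"
proof -
  have "i + j * n < Suc j * n" using assms(1) by simp
  also have "\<dots> \<le> k * n" using assms(2) by (intro mult_le_mono1) simp
  finally show ?thesis .
qed

lemma std_shuffle_eq:
  assumes "i < n" "j < k"
  shows "std_shuffle k n (i + j * n) = i * k + j"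
  using assms add_mult_less[OF assms] by (simp add: std_shuffle_def)

lemma pile_perm_eq:
  assumes "i < n" "j < k"
  shows "pile_perm k n \<tau> (i + j * n) = i + \<tau> j * n"
  using assms add_mult_less[OF assms] by (simp add: pile_perm_def)

lemma point_decomp:
  fixes x k n :: nat
  assumes "x < k * n"
  obtains i j where "i < n" "j < k" "x = i + j * n"
proof
  have "n > 0" using assms by (cases n) auto
  then show "x mod n < n" by simp
  show "x div n < k" using assms by (simp add: less_mult_imp_div_less)
  show "x = x mod n + x div n * n" by simp
qed

lemma std_shuffle_permutes: "std_shuffle k n permutes {..<k * n}"
proof (rule bij_imp_permutes)
  have "inj_on (std_shuffle k n) {..<k * n}"
  proof (rule inj_onI)
    fix x y
    assume "x \<in> {..<k * n}" "y \<in> {..<k * n}" and eq: "std_shuffle k n x = std_shuffle k n y"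
    then obtain i j i' j' where ij: "i < n" "j < k" "x = i + j * n" "i' < n" "j' < k" "y = i' + j' * n"
      by (meson lessThan_iff point_decomp)
    then have *: "j + i * k = j' + i' * k"
      using eq by (simp add: std_shuffle_eq add.commute)
    have "j = j'" using arg_cong[OF *, of "\<lambda>z. z mod k"] ij by simp
    moreover have "i = i'" using arg_cong[OF *, of "\<lambda>z. z div k"] ij by simp
    ultimately show "x = y" using ij by simp
  qed
  moreover have "std_shuffle k n ` {..<k * n} \<subseteq> {..<k * n}"
  proof (clarsimp)
    fix x assume "x < k * n"
    then obtain i j where "i < n" "j < k" "x = i + j * n" by (rule point_decomp)
    then show "std_shuffle k n x < k * n"
      using add_mult_less[of j k i n] by (simp add: std_shuffle_eq add.commute mult.commute)
  qed
  ultimately show "bij_betw (std_shuffle k n) {..<k * n} {..<k * n}"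
    by (simp add: bij_betw_def endo_inj_surj)
qed (simp add: std_shuffle_def)

lemma pile_perm_permutes:
  assumes "\<tau> permutes {..<k}"
  shows "pile_perm k n \<tau> permutes {..<k * n}"
proof (rule bij_imp_permutes)
  have t: "\<tau> j < k" if "j < k" for j using permutes_in_image[OF assms, of j] that by simp
  have "inj_on (pile_perm k n \<tau>) {..<k * n}"
  proof (rule inj_onI)
    fix x y
    assume "x \<in> {..<k * n}" "y \<in> {..<k * n}" and eq: "pile_perm k n \<tau> x = pile_perm k n \<tau> y"
    then obtain i j i' j' where ij: "i < n" "j < k" "x = i + j * n" "i' < n" "j' < k" "y = i' + j' * n"
      by (meson lessThan_iff point_decomp)
    then have *: "i + \<tau> j * n = i' + \<tau> j' * n"
      using eq by (simp add: pile_perm_eq)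
    have "i = i'" using arg_cong[OF *, of "\<lambda>z. z mod n"] ij by simp
    moreover have "\<tau> j = \<tau> j'" using arg_cong[OF *, of "\<lambda>z. z div n"] ij by simp
    then have "j = j'" using permutes_inj[OF assms] by (simp add: inj_eq)
    ultimately show "x = y" using ij by simp
  qed
  moreover have "pile_perm k n \<tau> ` {..<k * n} \<subseteq> {..<k * n}"
  proof (clarsimp)
    fix x assume "x < k * n"
    then obtain i j where "i < n" "j < k" "x = i + j * n" by (rule point_decomp)
    then show "pile_perm k n \<tau> x < k * n"
      using add_mult_less[of i n "\<tau> j" k] t by (simp add: pile_perm_eq)
  qed
  ultimately show "bij_betw (pile_perm k n \<tau>) {..<k * n} {..<k * n}"
    by (simp add: bij_betw_def endo_inj_surj)
qed (simp add: pile_perm_def)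

lemma shuffle_group_subgroup: "subgroup (shuffle_group k n) (Sym {..<k * n})"
  unfolding shuffle_group_def
  by (rule group.generate_is_subgroup[OF group_Sym])
     (auto simp: Sym_def intro: permutes_compose pile_perm_permutes std_shuffle_permutes)

end

theory Submission
  imports Defs
begin

text \<open>
  Write \<open>n = k ^ e * m\<close> with \<open>k\<close> not dividing \<open>m\<close>; the hypothesis gives \<open>m \<ge> 2\<close>. A point is
  \<open>a + u * k ^ e\<close> with \<open>a < k ^ e\<close> and \<open>u < k * m\<close>, and conjugating the pile permutations by powers of
  the shuffle permutes each of the \<open>e + 1\<close> lowest base-\<open>k\<close> digits separately. So the group acts on
  the component \<open>u\<close> by permuting the top pile \<open>u div m\<close> and by permuting the last digit \<open>u mod k\<close>.

  These two kinds of moves already act 2-transitively on \<open>[k * m]\<close>. First, all pairs lying in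
  different piles are in one orbit, because \<open>k\<close> does not divide \<open>m\<close>. Any pair outside this orbit
  has equal piles; walking down within a pile shows that it also has equal last digits. Hence
  every move preserves the difference of such a pair, and moving both points down
  ends in a contradiction. Finally the shuffle feeds the digits of \<open>u\<close> through those of \<open>a\<close>, so
  the stabilizer of \<open>0\<close> is transitive on the remaining points.
\<close>

section \<open>Congruences of natural numbers\<close>

lemma residue_two:
  fixes x :: nat
  assumes "x mod 3 = 2"
  shows "2 \<le> x" "(1 + 1) mod 3 \<noteq> (x - 1) mod 3" "(1 + 0) mod 3 \<noteq> (x - 1 + 1) mod 3"
proof -
  obtain q where x: "x = 3 * q + 2" using assms by (metis mult_div_mod_eq)
  show "2 \<le> x" using x by simp
  have "x - 1 = 1 + q * 3" using x by simp
  then show "(1 + 1) mod 3 \<noteq> (x - 1) mod 3" by (simp only: mod_mult_self1) simp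
  show "(1 + 0) mod 3 \<noteq> (x - 1 + 1) mod 3" using assms \<open>2 \<le> x\<close> by simp
qed

lemma mod_shift_neq:
  fixes a b c d t :: nat
  assumes "(a + c) mod t \<noteq> (b + c) mod t"
  shows "(a + d) mod t \<noteq> (b + d) mod t"
proof
  assume "(a + d) mod t = (b + d) mod t"
  then have "int (a + d) mod int t = int (b + d) mod int t"
    unfolding of_nat_mod[symmetric] by (rule arg_cong)
  then have "int t dvd int (a + d) - int (b + d)" unfolding mod_eq_dvd_iff .
  then have "int t dvd int (a + c) - int (b + c)" by simp
  then have "int (a + c) mod int t = int (b + c) mod int t" unfolding mod_eq_dvd_iff .
  then have "(a + c) mod t = (b + c) mod t" unfolding of_nat_mod[symmetric] of_nat_eq_iff .
  then show False using assms by contradiction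
qed

lemma mod_pred_eq:
  fixes x y t :: nat
  assumes "x > 0" "y > 0"
  shows "(x mod t = y mod t) = ((x - 1) mod t = (y - 1) mod t)"
  using mod_shift_neq[of "x - 1" 0 t "y - 1" 1] mod_shift_neq[of "x - 1" 1 t "y - 1" 0] assms
  by auto

section \<open>Sets of pairs closed under pile moves and last-digit moves\<close>

text \<open>
  \<open>Q\<close> stands for membership in a union of orbits on pairs. Two symbols can be permuted to any two
  symbols with the same equality pattern, so invariance is stated without permutations.
\<close>
locale pair_class =
  fixes k m :: nat and Q :: "nat \<Rightarrow> nat \<Rightarrow> bool"
  assumes k3: "k \<ge> 3" and ndvd: "\<not> k dvd m"
    and top: "\<And>x y x' y'. \<lbrakk>x < k * m; y < k * m; x' < k * m; y' < k * m;
      x mod m = x' mod m; y mod m = y' mod m;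
      (x div m = y div m) = (x' div m = y' div m); Q x y\<rbrakk> \<Longrightarrow> Q x' y'"
    and bot: "\<And>x y x' y'. \<lbrakk>x < k * m; y < k * m; x' < k * m; y' < k * m;
      x div k = x' div k; y div k = y' div k;
      (x mod k = y mod k) = (x' mod k = y' mod k); Q x y\<rbrakk> \<Longrightarrow> Q x' y'"
begin

lemma m_pos: "m > 0"
  using ndvd by (cases m) auto

lemma top_less: "i < m \<Longrightarrow> j < k \<Longrightarrow> i + j * m < k * m"
  by (rule add_mult_less)

lemma one_shift: "i < m \<Longrightarrow> i + m < k * m"
  using top_less[of i 1] k3 by simp

text \<open>For points in different piles the two piles can be chosen freely, so only the positions
  \<open>i\<close> and \<open>i'\<close> within the piles matter. \<open>Q i (i' + m)\<close>, with
  piles 0 and 1, is used as the normal form.\<close>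

lemma top_iff:
  assumes "i < m" "i' < m" "j < k" "j' < k" "j \<noteq> j'"
  shows "Q (i + j * m) (i' + j' * m) \<longleftrightarrow> Q i (i' + m)"
proof -
  have d: "(i + j * m) mod m = i" "(i' + j' * m) mod m = i'"
    "(i + j * m) div m = j" "(i' + j' * m) div m = j'"
    "i mod m = i" "(i' + m) mod m = i'" "i div m = 0" "(i' + m) div m = 1"
    using assms m_pos by (simp_all add: div_add_self2)
  have l: "i < k * m" using top_less[of i 0] assms k3 by simp
  note b = top_less[OF assms(1,3)] top_less[OF assms(2,4)] l one_shift[OF assms(2)]
  have e: "i mod m = (i + j * m) mod m" "(i' + m) mod m = (i' + j' * m) mod m"
    "(i div m = (i' + m) div m) = ((i + j * m) div m = (i' + j' * m) div m)"
    unfolding d using assms(5) by simp_all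
  show ?thesis
    using top[OF b(3,4,1,2) e] top[OF b(1,2,3,4) e(1)[symmetric] e(2)[symmetric] e(3)[symmetric]]
    by blast
qed

lemma flip: "pair_class k m (\<lambda>x y. Q y x)"
proof
  show "k \<ge> 3" "\<not> k dvd m" by (fact k3 ndvd)+
next
  fix x y x' y'
  assume "x < k * m" "y < k * m" "x' < k * m" "y' < k * m" "x mod m = x' mod m" "y mod m = y' mod m"
    "(x div m = y div m) = (x' div m = y' div m)" "Q y x"
  then show "Q y' x'" using top[of y x y' x'] by (metis (full_types))
next
  fix x y x' y'
  assume "x < k * m" "y < k * m" "x' < k * m" "y' < k * m" "x div k = x' div k" "y div k = y' div k"
    "(x mod k = y mod k) = (x' mod k = y' mod k)" "Q y x"
  then show "Q y' x'" using bot[of y x y' x'] by (metis (full_types))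
qed

text \<open>The complement of a union of orbits is a union of orbits. Hence non-membership can be
  carried along moves, on which the later proofs by contradiction rest.\<close>

lemma complement: "pair_class k m (\<lambda>x y. \<not> Q x y)"
proof
  show "k \<ge> 3" "\<not> k dvd m" by (fact k3 ndvd)+
next
  fix x y x' y'
  assume "x < k * m" "y < k * m" "x' < k * m" "y' < k * m" "x mod m = x' mod m" "y mod m = y' mod m"
    "(x div m = y div m) = (x' div m = y' div m)" "\<not> Q x y"
  then show "\<not> Q x' y'" using top[of x' y' x y] by metis
next
  fix x y x' y'
  assume "x < k * m" "y < k * m" "x' < k * m" "y' < k * m" "x div k = x' div k" "y div k = y' div k"
    "(x mod k = y mod k) = (x' mod k = y' mod k)" "\<not> Q x y"
  then show "\<not> Q x' y'" using bot[of x' y' x y] by metis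
qed

section \<open>Pairs in different piles\<close>

text \<open>One round of moves: go from piles 0 and 1 to piles \<open>j\<close> and
  \<open>j'\<close>, change the last digits there, and return. The last digits must differ before
  and after, because a permutation of digits preserves equality and inequality.\<close>

lemma move:
  assumes "i < m" "i' < m" "a < m" "a' < m" "j < k" "j' < k" "j \<noteq> j'"
    and "(i + j * m) div k = (a + j * m) div k" "(i' + j' * m) div k = (a' + j' * m) div k"
    and "(i + j * m) mod k \<noteq> (i' + j' * m) mod k" "(a + j * m) mod k \<noteq> (a' + j' * m) mod k"
    and "Q i (i' + m)"
  shows "Q a (a' + m)"
proof -
  have "Q (i + j * m) (i' + j' * m)" using assms top_iff by simp
  then have "Q (a + j * m) (a' + j' * m)"
    using bot[of "i + j * m" "i' + j' * m" "a + j * m" "a' + j' * m"] assms top_less by simp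
  then show ?thesis using assms top_iff by simp
qed

text \<open>In these piles \<open>move\<close> can raise \<open>i\<close> by one: the step crosses
  no multiple of \<open>k\<close>, and neither end shares its last digit with the other point. For
  \<open>k \<ge> 4\<close> three candidates for \<open>j'\<close> suffice.\<close>

lemma exists_piles:
  assumes "k \<ge> 4"
  obtains j j' where "j < k" "j' < k" "j \<noteq> j'" "\<not> k dvd i + j * m + 1"
    "(i + j * m) mod k \<noteq> (i' + j' * m) mod k" "(i + j * m + 1) mod k \<noteq> (i' + j' * m) mod k"
proof -
  have small: "\<not> int k dvd z" if "z \<in> {1, 2, 3, -1, -2, -3}" for z
    using that assms zdvd_not_zless[of "\<bar>z\<bar>" "int k"] by auto
  have nd: "\<not> int k dvd int m" using ndvd by simp
  obtain j where j: "j < 2" "\<not> k dvd i + j * m + 1"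
  proof (cases "k dvd i + 1")
    case True
    then have "\<not> k dvd (i + 1) + m" using ndvd dvd_add_right_iff by blast
    then show thesis using that[of 1] by (simp add: ac_simps)
  next
    case False
    then show thesis using that[of 0] by simp
  qed
  \<comment> \<open>\<open>D c\<close> says that pile \<open>c\<close> is unusable for the second
    point: its last digit collides with that of the first point before
    (\<open>\<epsilon> = 0\<close>) or after (\<open>\<epsilon> = 1\<close>) the step.\<close>
  define D where "D c \<longleftrightarrow> (\<exists>\<epsilon>\<in>{0, 1}. int k dvd int i' + int c * int m - (int i + int j * int m + \<epsilon>))" for c
  have "\<not> D 2 \<or> \<not> D 3 \<or> \<not> D (1 - j)"
  proof (rule ccontr)
    assume "\<not> ?thesis"
    then have D: "D 2" "D 3" "D (1 - j)" by simp_all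
    from D(1) obtain e2 where e2: "e2 \<in> {0, 1}"
      and d2: "int k dvd int i' + 2 * int m - (int i + int j * int m + e2)"
      unfolding D_def of_nat_numeral by blast
    from D(2) obtain e3 where e3: "e3 \<in> {0, 1}"
      and d3: "int k dvd int i' + 3 * int m - (int i + int j * int m + e3)"
      unfolding D_def of_nat_numeral by blast
    from D(3) obtain e1 where e1: "e1 \<in> {0, 1}"
      and d1: "int k dvd int i' + int (1 - j) * int m - (int i + int j * int m + e1)"
      unfolding D_def by blast
    \<comment> \<open>Eliminating \<open>i\<close>, \<open>i'\<close> and then \<open>m\<close>
      leaves a multiple of \<open>k\<close> of absolute value at most 3. It is therefore 0, which
      forces \<open>e3 = e2\<close> and so \<open>k dvd m\<close>.\<close>
    have m1: "int k dvd int m - (e3 - e2)"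
      using dvd_diff[OF d3 d2] by (simp add: algebra_simps)
    have "int k dvd (2 - int (1 - j)) * int m - (e2 - e1)"
      using dvd_diff[OF d2 d1] by (simp add: algebra_simps)
    from dvd_diff[OF dvd_mult[OF m1, of "2 - int (1 - j)"] this]
    have "int k dvd (e2 - e1) - (2 - int (1 - j)) * (e3 - e2)"
      by (simp add: algebra_simps)
    moreover have "j = 0 \<or> j = 1" using j by auto
    ultimately show False using e1 e2 e3 m1 nd small[of 1] small[of 2] small[of 3] small[of "-1"] small[of "-2"] small[of "-3"]
      by (elim disjE insertE emptyE) simp_all
  qed
  then obtain c where c: "c \<in> {2, 3, 1 - j}" "\<not> D c" by auto
  have "(i + j * m + e) mod k \<noteq> (i' + c * m) mod k" if "e \<in> {0, 1}" for e
  proof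
    assume "(i + j * m + e) mod k = (i' + c * m) mod k"
    then have "int (i' + c * m) mod int k = int (i + j * m + e) mod int k"
      by (metis of_nat_mod)
    then have "int k dvd int (i' + c * m) - int (i + j * m + e)"
      by (simp add: mod_eq_dvd_iff)
    then show False using c(2) that unfolding D_def by auto
  qed
  from this[of 0] this[of 1] show thesis
    using that[of j c] j c(1) assms by (auto simp: less_2_cases_iff)
qed

lemma div_Suc_same: "\<not> k dvd x + 1 \<Longrightarrow> (x + 1) div k = x div k"
  using k3 by (simp add: div_Suc dvd_eq_mod_eq_0)

lemma step_large:
  assumes "k \<ge> 4" "i + 1 < m" "i' < m" "Q i (i' + m)"
  shows "Q (i + 1) (i' + m)"
proof -
  obtain j j' where j: "j < k" "j' < k" "j \<noteq> j'" "\<not> k dvd i + j * m + 1"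
    "(i + j * m) mod k \<noteq> (i' + j' * m) mod k" "(i + j * m + 1) mod k \<noteq> (i' + j' * m) mod k"
    using exists_piles[OF assms(1), of i i'] by blast
  show ?thesis
    using move[of i i' "i + 1" i' j j'] div_Suc_same[OF j(4)] j assms by (simp add: ac_simps)
qed

lemma zero_large:
  assumes "k \<ge> 4" "i < m" "Q 0 (i' + m)" "i' < m"
  shows "Q i (i' + m)"
  using assms(2)
proof (induction i)
  case (Suc i)
  then show ?case using step_large[of i i'] assms by simp
qed (use assms in simp)

lemma top_flip:
  assumes "i < m" "i' < m"
  shows "Q (i' + m) i \<longleftrightarrow> Q i' (i + m)"
  using top_iff[of i' i 1 0] assms k3 by simp

text \<open>For \<open>k = 3\<close> the shift of one coordinate by one in \<open>step_large\<close> is not always available.\<close>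
lemma move3:
  assumes k: "k = 3"
    and "i < m" "i' < m" "a < m" "a' < m"
    and r: "r < 3" "r' < 3" "s < 3" "s' < 3" "r \<noteq> r'" "s \<noteq> s'"
    and ar: "a + r = i + s" "a' + r' = i' + s'"
    and ne: "(i + r') mod 3 \<noteq> (i' + r) mod 3"
    and "Q i (i' + m)"
  shows "Q a (a' + m)"
proof -
  \<comment> \<open>As \<open>m\<close> is invertible modulo 3, the piles realize every
    residue.\<close>
  have ex: "\<exists>j<3. (z + j * m) mod 3 = t" if "t < 3" for z t
  proof -
    have m: "m mod 3 = 1 \<or> m mod 3 = 2"
      using ndvd k mod_less_divisor[of 3 m] by (auto simp: dvd_eq_mod_eq_0)
    have z: "z mod 3 = 0 \<or> z mod 3 = 1 \<or> z mod 3 = 2" by auto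
    have t: "t = 0 \<or> t = 1 \<or> t = 2" using that by auto
    have e: "(z mod 3 + j * (m mod 3)) mod 3 = (z + j * m) mod 3" for j
      using mod_add_cong[OF mod_mod_trivial mod_mult_right_eq, of z 3 j m] by simp
    have "(z mod 3 + 0 * (m mod 3)) mod 3 = t \<or> (z mod 3 + 1 * (m mod 3)) mod 3 = t
      \<or> (z mod 3 + 2 * (m mod 3)) mod 3 = t"
      using m z t by (elim disjE) simp_all
    then have "(z + 0 * m) mod 3 = t \<or> (z + 1 * m) mod 3 = t \<or> (z + 2 * m) mod 3 = t"
      unfolding e .
    then show ?thesis by (elim disjE) (rule exI, rule conjI[rotated], assumption, simp)+
  qed
  obtain j where j: "j < 3" "(i + j * m) mod 3 = r" using ex r by blast
  obtain j' where j': "j' < 3" "(i' + j' * m) mod 3 = r'" using ex r by blast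
  have same: "(b + z) div 3 = (c + z) div 3 \<and> (b + z) mod 3 = t"
    if "(c + z) mod 3 = q" "b + q = c + t" "t < 3" for b c z q t :: nat
  proof -
    have "c + z = 3 * ((c + z) div 3) + q" using mult_div_mod_eq[of 3 "c + z"] that(1) by simp
    then have "b + z = 3 * ((c + z) div 3) + t" using that by linarith
    then show ?thesis using that by simp
  qed
  have jj: "j \<noteq> j'"
  proof
    assume "j = j'"
    then have "(i + r') mod 3 = (i + (i' + j * m)) mod 3" using j' by (metis mod_add_right_eq)
    also have "\<dots> = (i' + (i + j * m)) mod 3" by (simp add: ac_simps)
    also have "\<dots> = (i' + r) mod 3" using j by (metis mod_add_right_eq)
    finally show False using ne by simp
  qed
  note sa = same[OF j(2) ar(1) r(3)] and sa' = same[OF j'(2) ar(2) r(4)]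
  show ?thesis
  proof (rule move[OF assms(2-5)])
    show "j < k" "j' < k" "j \<noteq> j'" using j(1) j'(1) jj k by simp_all
    show "(i + j * m) div k = (a + j * m) div k" "(i' + j' * m) div k = (a' + j' * m) div k"
      using sa sa' k by simp_all
    show "(i + j * m) mod k \<noteq> (i' + j' * m) mod k" "(a + j * m) mod k \<noteq> (a' + j' * m) mod k"
      using j(2) j'(2) sa sa' r(5,6) k by simp_all
    show "Q i (i' + m)" by fact
  qed
qed

text \<open>Induction on \<open>i + i'\<close>, raising one position at a time. The congruences that
  block the two raises exclude each other, since together they would give 2 = 0 modulo 3. What
  remains, apart from the start, has one position 0 and the other congruent to 2.\<close>

lemma top_small:
  assumes "k = 3" "Q 0 m" "i < m" "i' < m"
  shows "Q i (i' + m)"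
  using assms(3,4)
proof (induction "i + i'" arbitrary: i i' rule: less_induct)
  case less
  note mv = move3[OF assms(1)]
  \<comment> \<open>The raised point changes its last digit from 0 to 1 while the other point keeps
    the digit 2.\<close>
  have down: "Q i (i' + m)"
    if "1 \<le> i" "i < m" "i' < m" "(i + 1) mod 3 \<noteq> i' mod 3" "Q (i - 1) (i' + m)" for i i'
    using mv[of "i - 1" i' i i' 0 2 1 2] that by simp
  have down': "Q i (i' + m)"
    if "1 \<le> i'" "i < m" "i' < m" "i mod 3 \<noteq> (i' + 1) mod 3" "Q i (i' - 1 + m)" for i i'
    using mv[of i "i' - 1" i i' 2 0 2 1] that by simp
  have "(i = 0 \<and> i' = 0) \<or> (1 \<le> i \<and> (i + 1) mod 3 \<noteq> i' mod 3)
    \<or> (1 \<le> i' \<and> i mod 3 \<noteq> (i' + 1) mod 3) \<or> (i = 0 \<and> i' mod 3 = 2) \<or> (i' = 0 \<and> i mod 3 = 2)"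
  proof -
    have "(i + 1) mod 3 \<noteq> i' mod 3 \<or> i mod 3 \<noteq> (i' + 1) mod 3"
      by (auto simp: mod_Suc split: if_splits)
    moreover have "i' = 0 \<longrightarrow> (i + 1) mod 3 \<noteq> i' mod 3 \<or> i mod 3 = 2"
      by (auto simp: mod_Suc split: if_splits)
    moreover have "i = 0 \<longrightarrow> i mod 3 \<noteq> (i' + 1) mod 3 \<or> i' mod 3 = 2"
      by (auto simp: mod_Suc split: if_splits)
    moreover have "i = 0 \<or> 1 \<le> i" "i' = 0 \<or> 1 \<le> i'" by auto
    ultimately show ?thesis by blast
  qed
  then consider "i = 0" "i' = 0" | "1 \<le> i" "(i + 1) mod 3 \<noteq> i' mod 3" | "1 \<le> i'" "i mod 3 \<noteq> (i' + 1) mod 3"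
    | "i = 0" "i' mod 3 = 2" | "i' = 0" "i mod 3 = 2"
    by blast
  then show ?case
  proof cases
    case 1
    then show ?thesis using assms by simp
  next
    case 2
    have "Q (i - 1) (i' + m)" using less.hyps[of "i - 1" i'] less.prems 2(1) by simp
    then show ?thesis using down[OF 2(1) less.prems 2(2)] by blast
  next
    case 3
    have "Q i (i' - 1 + m)" using less.hyps[of i "i' - 1"] less.prems 3(1) by simp
    then show ?thesis using down'[OF 3(1) less.prems 3(2)] by blast
  next
    case 4
    note i' = residue_two(1)[OF 4(2)] and n1 = residue_two(2)[OF 4(2)] and n2 = residue_two(3)[OF 4(2)]
    have b: "1 < m" "i' - 1 < m" using i' less.prems by auto
    \<comment> \<open>A detour: from positions \<open>(0, i' - 1)\<close> go to
      \<open>(1, i' - 1)\<close>, then exchange the last digits 1 and 0, which lowers the first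
      position and raises the second.\<close>
    have "Q (1 - 1) (i' - 1 + m)" using less.hyps[of 0 "i' - 1"] less.prems i' 4(1) by simp
    then have q: "Q 1 (i' - 1 + m)" using down[OF _ b n1] by blast
    show ?thesis unfolding 4(1)
      by (rule mv[of 1 "i' - 1" 0 i' 1 0 0 1, OF b _ less.prems(2) _ _ _ _ _ _ _ _ n2 q])
        (use i' m_pos in auto)
  next
    case 5
    note i = residue_two(1)[OF 5(2)] and n1 = residue_two(2)[OF 5(2), symmetric] and n2 = residue_two(3)[OF 5(2), symmetric]
    have b: "i - 1 < m" "1 < m" using i less.prems by auto
    have "Q (i - 1) (1 - 1 + m)" using less.hyps[of "i - 1" 0] less.prems i 5(1) by simp
    then have q: "Q (i - 1) (1 + m)" using down'[OF _ b n1] by blast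
    show ?thesis unfolding 5(1)
      by (rule mv[of "i - 1" 1 i 0 0 1 1 0, OF b less.prems(1) _ _ _ _ _ _ _ _ _ n2 q])
        (use i m_pos in auto)
  qed
qed

lemma top_diff:
  assumes "Q 0 m" "x < k * m" "y < k * m" "x div m \<noteq> y div m"
  shows "Q x y"
proof -
  have *: "Q i (i' + m)" if "i < m" "i' < m" for i i'
  proof (cases "k \<ge> 4")
    case True
    \<comment> \<open>\<open>zero_large\<close> raises only the first position, so the second one is
      raised beforehand in the flipped class.\<close>
    interpret f: pair_class k m "\<lambda>x y. Q y x" by (rule flip)
    have "Q (0 + m) 0" using top_flip[of 0 0] assms(1) m_pos by simp
    then have "Q (0 + m) i'" using f.zero_large[of i' 0] True that m_pos by simp
    then have "Q 0 (i' + m)" using top_flip[of i' 0] that m_pos by simp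
    then show ?thesis using zero_large True that by blast
  next
    case False
    then show ?thesis using top_small that assms k3 by simp
  qed
  have "Q (x mod m + (x div m) * m) (y mod m + (y div m) * m)"
    using top_iff[of "x mod m" "y mod m" "x div m" "y div m"] * assms m_pos
    by (simp add: less_mult_imp_div_less)
  then show ?thesis by simp
qed

section \<open>Pairs with different last digits\<close>

lemma shift_not_dvd:
  obtains j where "j < 2" "\<not> k dvd i + j * m"
proof (cases "k dvd i")
  case True
  then show ?thesis using that[of 1] ndvd by (simp add: dvd_add_right_iff)
next
  case False
  then show ?thesis using that[of 0] by simp
qed

text \<open>By \<open>top_diff\<close> a counterexample lies in a single pile. Lowering its first
  point by one, with the last digits kept distinct, gives a counterexample with smaller
  \<open>i\<close>, or for \<open>i = 0\<close> crosses a pile boundary and contradicts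
  \<open>top_diff\<close>.\<close>

lemma bottom_diff:
  assumes base: "Q 0 m"
  shows "\<lbrakk>i < m; j < k; y < k * m; (i + j * m) mod k \<noteq> y mod k\<rbrakk> \<Longrightarrow> Q (i + j * m) y"
proof (induction i arbitrary: j y rule: less_induct)
  case (less i)
  note i = less.prems(1) and j = less.prems(2) and y = less.prems(3) and ne = less.prems(4)
  interpret c: pair_class k m "\<lambda>x y. \<not> Q x y" by (rule complement)
  show "Q (i + j * m) y"
  proof (rule ccontr)
    assume nQ: "\<not> Q (i + j * m) y"
    have d: "(i + l * m) div m = l" "(i + l * m) mod m = i" for l using i by simp_all
    define i' where "i' = y mod m"
    have i': "i' < m" using m_pos by (simp add: i'_def)
    have d': "(i' + l * m) div m = l" "(i' + l * m) mod m = i'" for l using i' by simp_all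
    have "y div m = j"
      using top_diff[OF base top_less[OF i j] y] nQ d by auto
    then have y_eq: "y = i' + j * m" unfolding i'_def by (metis mod_div_mult_eq)
    \<comment> \<open>In pile \<open>l\<close> the first point is no multiple of \<open>k\<close>,
      so a last-digit move can lower it by one.\<close>
    obtain l where l: "l < 2" "\<not> k dvd i + l * m" by (rule shift_not_dvd)
    then have lk: "l < k" using k3 by simp
    define x where "x = i + l * m"
    define z where "z = i' + l * m"
    have x: "x < k * m" and z: "z < k * m"
      unfolding x_def z_def using top_less i i' lk by auto
    have nxz: "\<not> Q x z"
      using c.top[of "i + j * m" y x z] nQ x y z top_less[OF i j] d d' y_eq
      unfolding x_def z_def by simp
    have nexz: "x mod k \<noteq> z mod k"
      using mod_shift_neq ne unfolding x_def z_def y_eq by blast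
    \<comment> \<open>Since \<open>k \<ge> 3\<close>, one digit avoids the last digits of both
      \<open>x\<close> and \<open>x - 1\<close>, so the same partner \<open>w\<close> serves for
      both.\<close>
    obtain s where s: "s < k" "s \<noteq> x mod k" "s \<noteq> (x - 1) mod k"
    proof -
      have "card {x mod k, (x - 1) mod k} < card {..<k}"
        using k3 card_insert_le_m1[of 2 "{(x - 1) mod k}" "x mod k"] by simp
      then have "\<not> {..<k} \<subseteq> {x mod k, (x - 1) mod k}"
        by (metis card_mono finite.intros linorder_not_less)
      then show thesis using that by blast
    qed
    define w where "w = s + (z div k) * k"
    have w: "w div k = z div k" "w mod k = s" using s(1) by (simp_all add: w_def)
    have w_less: "w < k * m"
      using add_mult_less[of s k "z div k" m] s(1) z
      by (simp add: w_def less_mult_imp_div_less mult.commute)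
    have x1: "x mod k \<noteq> 0" using l by (simp add: x_def dvd_eq_mod_eq_0)
    then have xpos: "x > 0" by (cases x) auto
    then have sx: "Suc (x - 1) = x" by simp
    then have xd: "(x - 1) div k = x div k"
      using div_Suc_same[of "x - 1"] x1 by (simp add: dvd_eq_mod_eq_0)
    have n1: "\<not> Q x w"
      using c.bot[of x z x w] nxz x z w_less w s nexz by auto
    have n2: "\<not> Q (x - 1) w"
      using c.bot[of x z "x - 1" w] nxz x z w_less w s nexz xd by auto
    show False
    proof (cases i)
      case 0
      \<comment> \<open>Now \<open>x = m\<close>, so \<open>x\<close> and \<open>x - 1\<close> lie
        in different piles and at least one of them is not in the pile of \<open>w\<close>.\<close>
      then have l1: "l = 1" using l by (cases l) auto
      then have "x div m = 1" "(x - 1) div m = 0" using 0 m_pos by (auto simp: x_def)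
      then show False
        using top_diff[OF base x w_less] top_diff[OF base _ w_less, of "x - 1"] n1 n2 x by fastforce
    next
      case (Suc i0)
      then have "x - 1 = i0 + l * m" by (simp add: x_def)
      then show False using less.IH[of i0 l w] lk w_less n2 s w i Suc by auto
    qed
  qed
qed

section \<open>All pairs of distinct points\<close>

text \<open>A missing pair has equal piles and equal last digits, so both points can be moved in
  parallel. Every case produces a missing pair with smaller sum.\<close>

lemma Q_offdiag_base:
  assumes base: "Q 0 m"
  shows "\<lbrakk>x < k * m; y < k * m; x \<noteq> y\<rbrakk> \<Longrightarrow> Q x y"
proof (induction "x + y" arbitrary: x y rule: less_induct)
  case less
  interpret c: pair_class k m "\<lambda>x y. \<not> Q x y" by (rule complement)
  note T = top_diff[OF base]
  have B: "Q x y" if "x < k * m" "y < k * m" "x mod k \<noteq> y mod k" for x y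
    using bottom_diff[OF base, of "x mod m" "x div m" y] that m_pos
    by (simp add: less_mult_imp_div_less)
  show ?case
  proof (rule ccontr)
    assume nQ: "\<not> Q x y"
    have td: "x div m = y div m" and bd: "x mod k = y mod k"
      using nQ T B less.prems by blast+
    have mm: "x mod m \<noteq> y mod m" using td less.prems(3) by (metis div_mult_mod_eq)
    have ml: "z mod m < k * m" for z
      using top_less[of "z mod m" 0] m_pos k3 by simp
    show False
    proof (cases "x div m = 0")
      case False
      have "\<not> Q (x mod m) (y mod m)"
        using c.top[of x y "x mod m" "y mod m"] nQ less.prems td ml by simp
      moreover have "x mod m < x"
        using False m_pos by (metis mod_less_divisor div_eq_0_iff leI le_less_trans less_le not_less_iff_gr_or_eq mod_less_eq_dividend)
      moreover have "y mod m \<le> y" by simp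
      ultimately show False using less.hyps[of "x mod m" "y mod m"] ml mm by simp
    next
      case True
      then have xm: "x < m" and ym: "y < m" using td m_pos by (simp_all add: div_eq_0_iff)
      show False
      proof (cases "k dvd x")
        case False
        then have r: "x mod k \<noteq> 0" "y mod k \<noteq> 0" using bd by (auto simp: dvd_eq_mod_eq_0)
        then have pos: "x > 0" "y > 0" by (auto intro: gr0I)
        have nd: "\<not> k dvd (x - 1) + 1" "\<not> k dvd (y - 1) + 1"
          using r pos by (simp_all add: dvd_eq_mod_eq_0)
        have "\<not> Q (x - 1) (y - 1)"
          using c.bot[of x y "x - 1" "y - 1"] nQ less.prems div_Suc_same[OF nd(1)] div_Suc_same[OF nd(2)]
            pos mod_pred_eq[OF pos]
          by auto
        then show False using less.hyps[of "x - 1" "y - 1"] less.prems pos by (simp add: eq_diff_iff Suc_le_eq less_imp_diff_less)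
      next
        case True
        \<comment> \<open>Multiples of \<open>k\<close> cannot be lowered by a last-digit move. In
          pile 1 the points are no multiples of \<open>k\<close>, so they are lowered there and
          brought back.\<close>
        define x' where "x' = x + m"
        define y' where "y' = y + m"
        have l: "x' < k * m" "y' < k * m" using one_shift xm ym by (simp_all add: x'_def y'_def)
        have dv: "x' div m = 1" "y' div m = 1" "x' mod m = x" "y' mod m = y"
          using xm ym by (simp_all add: x'_def y'_def div_add_self2)
        have "\<not> Q x' y'"
          using c.top[of x y x' y'] nQ less.prems l dv td xm ym by simp
        moreover have bd': "x' mod k = y' mod k"
          using bd unfolding x'_def y'_def by (metis mod_add_left_eq)
        moreover have "\<not> k dvd x'" using True ndvd unfolding x'_def by (simp add: dvd_add_right_iff)
        then have r: "x' mod k \<noteq> 0" "y' mod k \<noteq> 0" using bd' by (auto simp: dvd_eq_mod_eq_0)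
        moreover have pos: "x' > 0" "y' > 0" using m_pos by (auto simp: x'_def y'_def)
        moreover have nd: "\<not> k dvd (x' - 1) + 1" "\<not> k dvd (y' - 1) + 1"
          using r pos by (simp_all add: dvd_eq_mod_eq_0)
        ultimately have nQ': "\<not> Q (x' - 1) (y' - 1)"
          using c.bot[of x' y' "x' - 1" "y' - 1"] l div_Suc_same[OF nd(1)] div_Suc_same[OF nd(2)]
            pos mod_pred_eq[OF pos]
          by auto
        then have dd: "(x' - 1) div m = (y' - 1) div m"
          using T[of "x' - 1" "y' - 1"] l by (auto simp: less_imp_diff_less)
        have z: "(u + m - 1) div m = (if u = 0 then 0 else 1) \<and> (u > 0 \<longrightarrow> (u + m - 1) mod m = u - 1)"
          if "u < m" for u
        proof (cases u)
          case (Suc v)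
          then have "u + m - 1 = v + m" by simp
          then show ?thesis using that Suc by (simp add: div_add_self2)
        qed (use m_pos in simp)
        note zx = z[OF xm, folded x'_def] and zy = z[OF ym, folded y'_def]
        \<comment> \<open>If exactly one of \<open>x\<close> and \<open>y\<close> were 0, lowering
          would drop only that point into pile 0.\<close>
        have "(if x = 0 then 0 else 1 :: nat) = (if y = 0 then 0 else 1)"
          using dd zx zy by presburger
        then have pxy: "x > 0" "y > 0" using less.prems(3) by (auto split: if_splits)
        have l': "x' - 1 < k * m" "y' - 1 < k * m" "x - 1 < k * m" "y - 1 < k * m"
          using l less.prems by (simp_all add: less_imp_diff_less)
        have md: "(x' - 1) mod m = (x - 1) mod m" "(y' - 1) mod m = (y - 1) mod m"
          using zx zy pxy xm ym by (simp_all add: less_imp_diff_less)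
        have "(x - 1) div m = 0" "(y - 1) div m = 0" using xm ym by simp_all
        with dd have "((x' - 1) div m = (y' - 1) div m) = ((x - 1) div m = (y - 1) div m)"
          by metis
        from c.top[OF l' md this nQ'] have "\<not> Q (x - 1) (y - 1)" .
        then show False using less.hyps[of "x - 1" "y - 1"] less.prems pxy by (simp add: eq_diff_iff Suc_le_eq less_imp_diff_less)
      qed
    qed
  qed
qed

text \<open>Either \<open>Q\<close> or its complement holds at \<open>0\<close>, \<open>m\<close>
  and hence at all pairs of distinct points; the given pair rules out the complement.\<close>

lemma Q_offdiag:
  assumes "Q x y" "x \<noteq> y" "x' \<noteq> y'" "x < k * m" "y < k * m" "x' < k * m" "y' < k * m"
  shows "Q x' y'"
proof (cases "Q 0 m")
  case True
  then show ?thesis using Q_offdiag_base assms by blast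
next
  case False
  then show ?thesis using pair_class.Q_offdiag_base[OF complement] assms by blast
qed

end

section \<open>Base-\<open>k\<close> digits and the reduction of \<open>[k * n]\<close> to
  \<open>[k * m]\<close>\<close>

locale shuffle_pairs =
  fixes k n :: nat and P :: "nat \<Rightarrow> nat \<Rightarrow> bool"
  assumes k3: "k \<ge> 3" and n_pos: "n > 0"
    and top: "\<And>x y x' y'. \<lbrakk>x < k * n; y < k * n; x' < k * n; y' < k * n;
      x mod n = x' mod n; y mod n = y' mod n;
      (x div n = y div n) = (x' div n = y' div n); P x y\<rbrakk> \<Longrightarrow> P x' y'"
    and shuffle_iff: "\<And>x y. \<lbrakk>x < k * n; y < k * n\<rbrakk> \<Longrightarrow>
      P (std_shuffle k n x) (std_shuffle k n y) \<longleftrightarrow> P x y"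
begin

text \<open>The inverse of the standard shuffle on \<open>{..<k * n}\<close>: the last
  base-\<open>k\<close> digit becomes the pile.\<close>

definition unshuffle :: "nat \<Rightarrow> nat" where
  "unshuffle x = x div k + (x mod k) * n"

lemma unshuffle:
  assumes "x < k * n"
  shows "unshuffle x < k * n" "std_shuffle k n (unshuffle x) = x"
    "unshuffle x mod n = x div k" "unshuffle x div n = x mod k"
proof -
  have "x div k < n" "x mod k < k"
    using assms k3 by (simp_all add: less_mult_imp_div_less mult.commute)
  then show "unshuffle x < k * n" "std_shuffle k n (unshuffle x) = x"
    "unshuffle x mod n = x div k" "unshuffle x div n = x mod k"
    unfolding unshuffle_def by (simp_all add: add_mult_less std_shuffle_eq)
qed

lemma unshuffle_iff: "x < k * n \<Longrightarrow> y < k * n \<Longrightarrow> P (unshuffle x) (unshuffle y) \<longleftrightarrow> P x y"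
  using shuffle_iff[of "unshuffle x" "unshuffle y"] unshuffle by simp

text \<open>Unshuffling turns digit 0 into the pile and, as \<open>k ^ t dvd n\<close>, moves digits
  1 to \<open>t\<close> down one place. After \<open>t + 1\<close> rounds digit \<open>t\<close> is
  the pile, where it can be permuted before shuffling back.\<close>

lemma digit:
  assumes "k ^ t dvd n" "x < k * n" "y < k * n" "x' < k * n" "y' < k * n"
    and "x mod k ^ t = x' mod k ^ t" "y mod k ^ t = y' mod k ^ t"
    and "x div k ^ t div k = x' div k ^ t div k" "y div k ^ t div k = y' div k ^ t div k"
    and "(x div k ^ t mod k = y div k ^ t mod k) = (x' div k ^ t mod k = y' div k ^ t mod k)"
    and "P x y"
  shows "P x' y'"
  using assms
proof (induction t arbitrary: x y x' y')
  case 0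
  have "P (unshuffle x) (unshuffle y)" using unshuffle_iff 0 by blast
  then have "P (unshuffle x') (unshuffle y')"
    using top[of "unshuffle x" "unshuffle y" "unshuffle x'" "unshuffle y'"] unshuffle 0 by simp
  then show ?case using unshuffle_iff 0 by blast
next
  case (Suc t)
  obtain q where n: "n = k ^ Suc t * q" using Suc.prems(1) by blast
  have e: "unshuffle z = z div k + k ^ t * (z mod k * k * q)" for z
    unfolding unshuffle_def by (simp add: n ac_simps)
  have kt: "k ^ t > 0" using k3 by simp
  have m: "unshuffle z mod k ^ t = z div k mod k ^ t" for z unfolding e by simp
  have d: "unshuffle z div k ^ t = z div k ^ Suc t + z mod k * q * k" for z
    unfolding e using kt by (subst div_mult_self2) (simp_all add: div_mult2_eq ac_simps)
  have dm: "unshuffle z div k ^ t mod k = z div k ^ Suc t mod k" for z unfolding d by simp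
  have dd: "unshuffle z div k ^ t div k = z div k ^ Suc t div k + z mod k * q" for z
    unfolding d using k3 by simp
  have mm: "z mod k = z' mod k \<and> z div k mod k ^ t = z' div k mod k ^ t"
    if "z mod k ^ Suc t = z' mod k ^ Suc t" for z z'
  proof -
    have "z mod k ^ Suc t = k * (z div k mod k ^ t) + z mod k"
      "z' mod k ^ Suc t = k * (z' div k mod k ^ t) + z' mod k"
      by (simp_all add: mod_mult2_eq)
    then have *: "k * (z div k mod k ^ t) + z mod k = k * (z' div k mod k ^ t) + z' mod k"
      using that by simp
    show ?thesis using arg_cong[OF *, of "\<lambda>u. u mod k"] arg_cong[OF *, of "\<lambda>u. u div k"] k3 by simp
  qed
  note mx = mm[OF Suc.prems(6)] and my = mm[OF Suc.prems(7)]
  have "P (unshuffle x') (unshuffle y')"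
  proof (rule Suc.IH[of "unshuffle x" "unshuffle y"])
    show "k ^ t dvd n" using n by simp
    show "unshuffle x < k * n" "unshuffle y < k * n" "unshuffle x' < k * n" "unshuffle y' < k * n"
      using unshuffle(1) Suc.prems by blast+
    show "unshuffle x mod k ^ t = unshuffle x' mod k ^ t" "unshuffle y mod k ^ t = unshuffle y' mod k ^ t"
      unfolding m using mx my by simp_all
    show "unshuffle x div k ^ t div k = unshuffle x' div k ^ t div k"
      "unshuffle y div k ^ t div k = unshuffle y' div k ^ t div k"
      unfolding dd using mx my Suc.prems(8,9) by simp_all
    show "(unshuffle x div k ^ t mod k = unshuffle y div k ^ t mod k) =
      (unshuffle x' div k ^ t mod k = unshuffle y' div k ^ t mod k)"
      unfolding dm by (fact Suc.prems(10))
    show "P (unshuffle x) (unshuffle y)" using unshuffle_iff Suc.prems by blast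
  qed
  then show ?case using unshuffle_iff Suc.prems by blast
qed

text \<open>For a low part \<open>c\<close> below \<open>k ^ e\<close>, the pile of
  \<open>c + u * k ^ e\<close> is \<open>u div m\<close> and its digit at place \<open>e\<close> is
  \<open>u mod k\<close>. With the low parts fixed, both kinds of moves thus act on the high
  parts.\<close>

lemma pair_class_lift:
  assumes n: "n = k ^ e * m" and nd: "\<not> k dvd m" and ab: "a < k ^ e" "b < k ^ e"
  shows "pair_class k m (\<lambda>u w. P (a + u * k ^ e) (b + w * k ^ e))"
proof -
  have ke: "k ^ e > 0" using k3 by simp
  have m: "m > 0" using n_pos n by simp
  have l: "c + u * k ^ e < k * n" if "c < k ^ e" "u < k * m" for c u
    using add_mult_less[OF that] unfolding n by (simp add: ac_simps)
  have dv: "(c + u * k ^ e) div k ^ e = u" "(c + u * k ^ e) mod k ^ e = c" if "c < k ^ e" for c u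
    using that k3 by simp_all
  have tn: "(c + u * k ^ e) div n = u div m" "(c + u * k ^ e) mod n = c + k ^ e * (u mod m)"
    if "c < k ^ e" for c u
    unfolding n div_mult2_eq mod_mult2_eq using dv[OF that] by simp_all
  show ?thesis
  proof
    show "k \<ge> 3" "\<not> k dvd m" by (fact k3 nd)+
  next
    fix x y x' y'
    assume L: "x < k * m" "y < k * m" "x' < k * m" "y' < k * m" and M: "x mod m = x' mod m"
      "y mod m = y' mod m" and D: "(x div m = y div m) = (x' div m = y' div m)"
      and P: "P (a + x * k ^ e) (b + y * k ^ e)"
    show "P (a + x' * k ^ e) (b + y' * k ^ e)"
      by (rule top[OF l l l l _ _ _ P]; (rule ab L)?; simp only: tn[OF ab(1)] tn[OF ab(2)] M D)
  next
    fix x y x' y'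
    assume L: "x < k * m" "y < k * m" "x' < k * m" "y' < k * m" and Q: "x div k = x' div k"
      "y div k = y' div k" and D: "(x mod k = y mod k) = (x' mod k = y' mod k)"
      and P: "P (a + x * k ^ e) (b + y * k ^ e)"
    have dn: "k ^ e dvd n" using n by simp
    show "P (a + x' * k ^ e) (b + y' * k ^ e)"
      by (rule digit[OF dn l l l l _ _ _ _ _ P]; (rule ab L)?; simp only: dv[OF ab(1)] dv[OF ab(2)] Q D)
  qed
qed

text \<open>For a fixed low part, \<open>Q_offdiag\<close> makes all nonzero high parts equivalent.
  Low parts are built up digit by digit, and a point below \<open>k ^ e\<close> is multiplied by
  \<open>k\<close>, which is what the shuffle does below \<open>n\<close>, until its high part is
  nonzero.\<close>

lemma zero_pair:
  assumes n: "n = k ^ e * m" and nd: "\<not> k dvd m" and m2: "m \<ge> 2"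
    and base: "P 0 n" and y: "0 < y" "y < k * n"
  shows "P 0 y"
proof -
  have ke: "k ^ e > 0" using k3 by simp
  have const: "P 0 (b + w' * k ^ e)"
    if "b < k ^ e" "P 0 (b + w * k ^ e)" "0 < w" "w < k * m" "0 < w'" "w' < k * m" for b w w'
    using pair_class.Q_offdiag[OF pair_class_lift[OF n nd ke that(1)], of 0 w 0 w'] that m2 k3 by simp
  have low: "P 0 (b + w * k ^ e)" if "t \<le> e" "b < k ^ t" "0 < w" "w < k * m" for t b w
    using that
  proof (induction t arbitrary: b w)
    case 0
    have "P 0 (0 + m * k ^ e)" using base n by (simp add: mult.commute)
    then show ?case using const[of 0 m w] 0 ke m2 k3 by simp
  next
    case (Suc t)
    obtain f where e: "e = Suc f" using Suc.prems(1) by (cases e) auto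
    have "k ^ Suc t \<le> k ^ e" using Suc.prems(1) k3 by (intro power_increasing) auto
    then have b: "b < k ^ e" using Suc.prems(2) by simp
    have c: "b div k < k ^ t" using Suc.prems(2) by (simp add: less_mult_imp_div_less mult.commute)
    have r: "b mod k < k" using k3 by simp
    \<comment> \<open>The high part \<open>k\<close> is chosen because unshuffling then shortens the
      low part to \<open>b div k\<close> and leaves a nonzero high part.\<close>
    have kk: "k < k * m" using m2 k3 by simp
    have z: "b + k * k ^ e < k * n"
      using add_mult_less[OF b kk] n by (simp add: ac_simps)
    have "unshuffle (b + k * k ^ e) = b div k + k ^ e + (b mod k) * n"
      unfolding unshuffle_def using k3 by simp
    also have "\<dots> = b div k + (1 + (b mod k) * m) * k ^ e"
      unfolding n by (simp add: algebra_simps)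
    finally have u: "unshuffle (b + k * k ^ e) = b div k + (1 + (b mod k) * m) * k ^ e" .
    have w: "1 + (b mod k) * m < k * m" using add_mult_less[of 1 m "b mod k" k] m2 r by simp
    have "P 0 (unshuffle (b + k * k ^ e))"
      unfolding u using Suc.IH[OF _ c _ w] Suc.prems(1) by simp
    moreover have "unshuffle 0 = 0" by (simp add: unshuffle_def)
    ultimately have "P 0 (b + k * k ^ e)"
      using unshuffle_iff[of 0 "b + k * k ^ e"] z k3 n_pos by simp
    then show ?case using const[of b k w] b k3 kk Suc.prems by simp
  qed
  have big: "P 0 z" if "k ^ e \<le> z" "z < k * n" for z
  proof -
    have "z div k ^ e < k * m"
      using that(2) unfolding n by (simp add: less_mult_imp_div_less ac_simps)
    moreover have "0 < z div k ^ e" using that(1) ke by (simp add: div_greater_zero_iff)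
    moreover have "z mod k ^ e < k ^ e" using ke by simp
    ultimately have "P 0 (z mod k ^ e + z div k ^ e * k ^ e)" using low by blast
    then show ?thesis unfolding mod_div_mult_eq .
  qed
  show ?thesis using y
  proof (induction "k ^ e - y" arbitrary: y rule: less_induct)
    case less
    show ?case
    proof (cases "k ^ e \<le> y")
      case True
      then show ?thesis using big less.prems by blast
    next
      case False
      moreover have "k ^ e \<le> n" using n m2 by simp
      ultimately have yn: "y < n" by simp
      have y1: "y < k * y" using less.prems k3 by simp
      have y2: "k * y < k * n" using yn k3 by simp
      have "k ^ e - k * y < k ^ e - y" using y1 False by linarith
      then have "P 0 (k * y)" using less.hyps[of "k * y"] y1 y2 by linarith
      moreover have "std_shuffle k n y = k * y" "std_shuffle k n 0 = 0"
        using yn less.prems k3 by (simp_all add: std_shuffle_def)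
      ultimately show ?thesis using shuffle_iff[of 0 y] less.prems k3 n_pos by simp
    qed
  qed
qed

end

section \<open>The shuffle group and its orbits on pairs\<close>

text \<open>The first transposition sends \<open>a\<close> to \<open>c\<close>. The second corrects
  the image of \<open>b\<close> and leaves \<open>c\<close> in place.\<close>

lemma exists_permutes_pair:
  fixes a b c d :: nat
  assumes "a < k" "b < k" "c < k" "d < k" "(a = b) = (c = d)"
  obtains \<tau> where "\<tau> permutes {..<k}" "\<tau> a = c" "\<tau> b = d"
proof -
  let ?p = "transpose a c"
  let ?q = "transpose (?p b) d"
  have p: "?p permutes {..<k}" using assms by (intro permutes_swap_id) auto
  then have "?p b < k" using permutes_in_image[OF p, of b] assms by simp
  then have q: "?q permutes {..<k}" using assms by (intro permutes_swap_id) auto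
  have "(?q \<circ> ?p) permutes {..<k}" using permutes_compose[OF p q] .
  moreover have "(?q \<circ> ?p) b = d" by simp
  moreover have "(?q \<circ> ?p) a = c"
  proof (cases "a = b")
    case True
    then show ?thesis using assms by simp
  next
    case False
    then have "?p b \<noteq> c" by (metis transpose_apply_first transpose_involutory)
    then show ?thesis using False assms by (auto simp: transpose_def)
  qed
  ultimately show thesis using that by blast
qed

lemma shuffle_group_comp:
  "g \<in> shuffle_group k n \<Longrightarrow> h \<in> shuffle_group k n \<Longrightarrow> g \<circ> h \<in> shuffle_group k n"
  using subgroup.m_closed[OF shuffle_group_subgroup, of h k n g] by (simp add: Sym_def)

lemma shuffle_group_permutes: "g \<in> shuffle_group k n \<Longrightarrow> g permutes {..<k * n}"
  using subgroup.subset[OF shuffle_group_subgroup, of k n] by (auto simp: Sym_def)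

lemma shuffle_group_id: "id \<in> shuffle_group k n"
  using subgroup.one_closed[OF shuffle_group_subgroup, of k n] by (simp add: Sym_def)

lemma shuffle_group_inverse:
  assumes "g \<in> shuffle_group k n"
  obtains h where "h \<in> shuffle_group k n" "h \<circ> g = id" "g \<circ> h = id"
proof
  let ?S = "Sym {..<k * n}"
  interpret group ?S by (rule group_Sym)
  have g: "g \<in> carrier ?S" using assms subgroup.subset[OF shuffle_group_subgroup] by blast
  show "inv\<^bsub>?S\<^esub> g \<in> shuffle_group k n"
    using subgroup.m_inv_closed[OF shuffle_group_subgroup assms] .
  show "inv\<^bsub>?S\<^esub> g \<circ> g = id" using r_inv[OF g] by (simp add: Sym_def)
  show "g \<circ> inv\<^bsub>?S\<^esub> g = id" using l_inv[OF g] by (simp add: Sym_def)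
qed

lemma std_shuffle_in: "std_shuffle k n \<in> shuffle_group k n"
proof -
  have "pile_perm k n id = id" by (auto simp: pile_perm_def)
  then have "pile_perm k n id \<otimes>\<^bsub>Sym {..<k * n}\<^esub> std_shuffle k n = std_shuffle k n"
    by (simp add: Sym_def)
  then show ?thesis
    unfolding shuffle_group_def
    by (intro generate.incl CollectI exI[of _ id] conjI permutes_id) simp
qed

text \<open>The shuffle is cancelled from the generator that combines it with
  \<open>pile_perm k n \<tau>\<close>.\<close>

lemma pile_perm_in:
  assumes "\<tau> permutes {..<k}"
  shows "pile_perm k n \<tau> \<in> shuffle_group k n"
proof -
  obtain h where h: "h \<in> shuffle_group k n" "h \<circ> std_shuffle k n = id"
    using shuffle_group_inverse[OF std_shuffle_in] by metis
  have "pile_perm k n \<tau> \<otimes>\<^bsub>Sym {..<k * n}\<^esub> std_shuffle k n \<in> shuffle_group k n"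
    unfolding shuffle_group_def using assms by (intro generate.incl) blast
  then have "std_shuffle k n \<circ> pile_perm k n \<tau> \<in> shuffle_group k n" by (simp add: Sym_def)
  from shuffle_group_comp[OF h(1) this] h(2) show ?thesis by (simp add: o_assoc)
qed

text \<open>Each step decreases the point: from a positive pile it drops to pile 0, and a positive
  \<open>x\<close> in pile 0 is unshuffled and then returned to pile 0 as
  \<open>x div k\<close>.\<close>

lemma reach_zero:
  assumes "k \<ge> 3" "x < k * n"
  shows "\<exists>g\<in>shuffle_group k n. g x = 0"
  using assms(2)
proof (induction x rule: less_induct)
  case (less x)
  have n: "n > 0" using less.prems by (cases n) auto
  have pull: "\<exists>g\<in>shuffle_group k n. g y = 0"
    if "h \<in> shuffle_group k n" "\<exists>g\<in>shuffle_group k n. g (h y) = 0" for h y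
    using that shuffle_group_comp by (metis comp_apply)
  have pile: "\<exists>g\<in>shuffle_group k n. g (i + j * n) = 0"
    if "i < n" "j < k" "l < k" "\<exists>g\<in>shuffle_group k n. g (i + l * n) = 0" for i j l
  proof -
    have \<tau>: "transpose j l permutes {..<k}" using that by (intro permutes_swap_id) auto
    show ?thesis
      using pull[OF pile_perm_in[OF \<tau>], of "i + j * n"] that by (simp add: pile_perm_eq)
  qed
  obtain i j where ij: "i < n" "j < k" "x = i + j * n" using point_decomp less.prems by blast
  consider "x = 0" | "j > 0" | "j = 0" "i > 0" using ij by auto
  then show ?case
  proof cases
    case 1
    then show ?thesis using shuffle_group_id by (intro bexI[of _ id]) simp_all
  next
    case 2
    then have "i < x" using ij n by simp
    then have "\<exists>g\<in>shuffle_group k n. g (i + 0 * n) = 0" using less by simp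
    then show ?thesis using pile[OF ij(1,2), of 0] ij assms by simp
  next
    case 3
    then have xi: "x = i" using ij by simp
    define p r where "p = x div k" and "r = x mod k"
    have x: "x = p * k + r" by (simp add: p_def r_def)
    have px: "p < x" using 3 xi assms by (simp add: p_def)
    then have pn: "p < n" using xi ij by simp
    have rk: "r < k" using assms by (simp add: r_def)
    have "p < k * n" using px less.prems by simp
    then have p0: "\<exists>g\<in>shuffle_group k n. g (p + 0 * n) = 0" using less.IH[OF px] by simp
    obtain h where h: "h \<in> shuffle_group k n" "h \<circ> std_shuffle k n = id"
      using shuffle_group_inverse[OF std_shuffle_in] by metis
    have "std_shuffle k n (p + r * n) = x" using std_shuffle_eq[OF pn rk] x by simp
    then have "h x = p + r * n" using h(2) by (metis comp_apply id_apply)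
    moreover have "\<exists>g\<in>shuffle_group k n. g (p + r * n) = 0"
      using pile[OF pn rk _ p0] assms by simp
    ultimately show ?thesis using pull[OF h(1)] by simp
  qed
qed

text \<open>The pairs that can be carried to \<open>(u, v)\<close> are closed under moves, because a
  carrying element may be precomposed with any group element.\<close>

lemma shuffle_pairs_orbit:
  assumes "k \<ge> 3" "n > 0"
  shows "shuffle_pairs k n (\<lambda>x y. \<exists>g\<in>shuffle_group k n. g x = u \<and> g y = v)"
proof
  show "k \<ge> 3" "n > 0" by (fact assms)+
next
  fix x y x' y'
  assume l: "x < k * n" "y < k * n" "x' < k * n" "y' < k * n"
    and m: "x mod n = x' mod n" "y mod n = y' mod n"
    and d: "(x div n = y div n) = (x' div n = y' div n)"
    and "\<exists>g\<in>shuffle_group k n. g x = u \<and> g y = v"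
  then obtain g where g: "g \<in> shuffle_group k n" "g x = u" "g y = v" by blast
  have "x div n < k" "y div n < k" "x' div n < k" "y' div n < k"
    using l by (simp_all add: less_mult_imp_div_less)
  \<comment> \<open>\<open>\<tau>\<close> leads from the new piles back to the old ones, as
    \<open>g\<close> is applied after it.\<close>
  then obtain \<tau> where t: "\<tau> permutes {..<k}" "\<tau> (x' div n) = x div n" "\<tau> (y' div n) = y div n"
    using exists_permutes_pair d by metis
  have "pile_perm k n \<tau> x' = x" "pile_perm k n \<tau> y' = y"
    using l t m by (simp_all add: pile_perm_def flip: m)
  then show "\<exists>g\<in>shuffle_group k n. g x' = u \<and> g y' = v"
    using shuffle_group_comp[OF g(1) pile_perm_in[OF t(1)]] g
    by (intro bexI[of _ "g \<circ> pile_perm k n \<tau>"]) simp_all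
next
  fix x y
  assume "x < k * n" "y < k * n"
  obtain h where h: "h \<in> shuffle_group k n" "h \<circ> std_shuffle k n = id"
    using shuffle_group_inverse[OF std_shuffle_in] by metis
  have hs: "h (std_shuffle k n z) = z" for z using h(2) by (metis comp_apply id_apply)
  show "(\<exists>g\<in>shuffle_group k n. g (std_shuffle k n x) = u \<and> g (std_shuffle k n y) = v) \<longleftrightarrow>
    (\<exists>g\<in>shuffle_group k n. g x = u \<and> g y = v)"
  proof
    assume "\<exists>g\<in>shuffle_group k n. g (std_shuffle k n x) = u \<and> g (std_shuffle k n y) = v"
    then show "\<exists>g\<in>shuffle_group k n. g x = u \<and> g y = v"
      using shuffle_group_comp[OF _ std_shuffle_in] by (metis comp_apply)
  next
    assume "\<exists>g\<in>shuffle_group k n. g x = u \<and> g y = v"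
    then show "\<exists>g\<in>shuffle_group k n. g (std_shuffle k n x) = u \<and> g (std_shuffle k n y) = v"
      using shuffle_group_comp[OF _ h(1)] hs by (metis comp_apply)
  qed
qed

section \<open>Two-transitivity on \<open>[k * n]\<close>\<close>

lemma power_times_nondivisor:
  fixes k n :: nat
  assumes "k \<ge> 2" "n > 0"
  obtains e m where "n = k ^ e * m" "\<not> k dvd m"
proof -
  have "\<exists>e m. n = k ^ e * m \<and> \<not> k dvd m" using assms(2)
  proof (induction n rule: less_induct)
    case (less n)
    show ?case
    proof (cases "k dvd n")
      case True
      then obtain q where q: "n = k * q" by blast
      then have "q < n" "q > 0" using less.prems assms(1) by auto
      then obtain e m where "q = k ^ e * m" "\<not> k dvd m" using less.IH by blast
      then show ?thesis using q by (intro exI[of _ "Suc e"] exI[of _ m]) simp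
    next
      case False
      then show ?thesis by (intro exI[of _ 0] exI[of _ n]) simp
    qed
  qed
  then show thesis using that by blast
qed

theorem theorem1p4:
  fixes k n :: nat
  assumes "k \<ge> 3" and "n \<ge> 1"
    and "\<not> (\<exists>e::nat. n = k ^ e)"
  shows "two_transitive_on (shuffle_group k n) {..<k * n}"
proof -
  have n_pos: "n > 0" and k2: "k \<ge> 2" using assms by simp_all
  obtain e m where n: "n = k ^ e * m" "\<not> k dvd m"
    using power_times_nondivisor[OF k2 n_pos] .
  have "m \<noteq> 1" using n(1) assms(3) by auto
  moreover have "m \<noteq> 0" using n(2) by (cases m) auto
  ultimately have m2: "m \<ge> 2" by simp
  interpret P: shuffle_pairs k n "\<lambda>x y. \<exists>g\<in>shuffle_group k n. g x = 0 \<and> g y = n"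
    by (rule shuffle_pairs_orbit[OF assms(1) n_pos])
  have "\<exists>g\<in>shuffle_group k n. g 0 = 0 \<and> g n = n"
    using shuffle_group_id by (intro bexI[of _ id]) simp_all
  \<comment> \<open>The pair \<open>(0, n)\<close> serves as reference: by \<open>zero\<close> the
    stabilizer of 0 carries every other point to \<open>n\<close>.\<close>
  note zero = P.zero_pair[OF n m2 this]
  have canon: "\<exists>g\<in>shuffle_group k n. g x = 0 \<and> g y = n"
    if xy: "x < k * n" "y < k * n" "x \<noteq> y" for x y
  proof -
    obtain g where g: "g \<in> shuffle_group k n" "g x = 0" using reach_zero assms(1) xy by blast
    have p: "g permutes {..<k * n}" using g shuffle_group_permutes by blast
    have "g y < k * n" using permutes_in_image[OF p, of y] xy by simp
    moreover have "g y \<noteq> 0" using g xy permutes_inj[OF p] by (metis injD)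
    ultimately obtain h where "h \<in> shuffle_group k n" "h 0 = 0" "h (g y) = n" using zero by blast
    then show ?thesis using shuffle_group_comp[OF _ g(1)] g(2) by (metis comp_apply)
  qed
  show ?thesis
    unfolding two_transitive_on_def
  proof (intro ballI impI)
    fix x y u v
    assume "x \<in> {..<k * n}" "y \<in> {..<k * n}" "u \<in> {..<k * n}" "v \<in> {..<k * n}" "x \<noteq> y" "u \<noteq> v"
    then obtain g h where g: "g \<in> shuffle_group k n" "g x = 0" "g y = n"
      and h: "h \<in> shuffle_group k n" "h u = 0" "h v = n"
      using canon by (metis lessThan_iff)
    obtain h' where h': "h' \<in> shuffle_group k n" "h' \<circ> h = id"
      using shuffle_group_inverse[OF h(1)] by metis
    then have "h' 0 = u" "h' n = v" using h by (metis comp_apply id_apply)+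
    then show "\<exists>g\<in>shuffle_group k n. g x = u \<and> g y = v"
      using shuffle_group_comp[OF h'(1) g(1)] g by (metis comp_apply)
  qed
qed

end
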